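(* Let $\mathbb{F}$ be any field. Let $\mathcal{SS}$ be the class of strongly simple Hom-Lie algebras over $\mathbb{F}$, and let $\mathcal{MS}$ be the class of finite-dimensional anticommutative algebras over $\mathbb{F}$ that have at least one multiplicative simple Hom-Lie structure. Then $\mathcal{SS}=\mathcal{MS}$.
   Context: All algebras are finite dimensional over $\mathbb{F}$. An anticommutative algebra is a vector space $A$ with a bilinear product $[\cdot,\cdot]$ satisfying $[x,x]=0$ for all $x$; it is abelian if the product is zero. A twisting map of $A$ is a linear map $\sigma:A\to A$ with $[\sigma(x),[y,z]]+[\sigma(y),[z,x]]+[\sigma(z),[x,y]]=0$ for all $x,y,z\in A$; then $(A,[\cdot,\cdot],\sigma)$ is a Hom-Lie algebra. A Hom-ideal is a subspace $I$ with $[I,A]\subset I$ and $\sigma(I)\subset I$; a Hom-Lie algebra is simple if it is not abelian and its only Hom-ideals are $0$ and $A$. A strongly simple Hom-Lie algebra is a nonabelian anticommutative algebra $A$ such that $(A,[\cdot,\cdot],\sigma)$ is simple for every twisting map $\sigma$ of $A$. A multiplicative simple Hom-Lie structure on $A$ is a twisting map $\sigma$ with $\sigma([x,y])=[\sigma(x),\sigma(y)]$ for all $x,y\in A$ such that $(A,[\cdot,\cdot],\sigma)$ is a simple Hom-Lie algebra. *)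

theory Defs
  imports Complex_Main
begin

text \<open>
  An algebra lives on a whole type \<open>'a\<close>: its addition is that of the class \<^class>\<open>ab_group_add\<close>,
  while the scalar multiplication and the bracket are explicit parameters. The field is an
  arbitrary type \<open>'f\<close> of class \<^class>\<open>field\<close>.
\<close>

locale anticommutative_algebra = vector_space scale
  for scale :: "'f::field \<Rightarrow> 'a::ab_group_add \<Rightarrow> 'a" +
  fixes br :: "'a \<Rightarrow> 'a \<Rightarrow> 'a"
  assumes finite_dimensional: "\<exists>B. finite_dimensional_vector_space scale B"
    and br_linear_left: "Vector_Spaces.linear scale scale (\<lambda>x. br x y)"
    and br_linear_right: "Vector_Spaces.linear scale scale (\<lambda>y. br x y)"
    and br_self: "br x x = 0"
begin

definition abelian :: bool where
  "abelian \<longleftrightarrow> (\<forall>x y. br x y = 0)"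

definition twisting_map :: "('a \<Rightarrow> 'a) \<Rightarrow> bool" where
  "twisting_map \<sigma> \<longleftrightarrow> Vector_Spaces.linear scale scale \<sigma> \<and>
     (\<forall>x y z. br (\<sigma> x) (br y z) + br (\<sigma> y) (br z x) + br (\<sigma> z) (br x y) = 0)"

end

locale hom_lie_algebra = anticommutative_algebra scale br
  for scale :: "'f::field \<Rightarrow> 'a::ab_group_add \<Rightarrow> 'a" and br :: "'a \<Rightarrow> 'a \<Rightarrow> 'a" +
  fixes \<sigma> :: "'a \<Rightarrow> 'a"
  assumes twisting: "twisting_map \<sigma>"
begin

definition hom_ideal :: "'a set \<Rightarrow> bool" where
  "hom_ideal I \<longleftrightarrow> subspace I \<and> (\<forall>x\<in>I. \<forall>y. br x y \<in> I) \<and> \<sigma> ` I \<subseteq> I"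

end

locale simple_hom_lie_algebra = hom_lie_algebra scale br \<sigma>
  for scale :: "'f::field \<Rightarrow> 'a::ab_group_add \<Rightarrow> 'a" and br :: "'a \<Rightarrow> 'a \<Rightarrow> 'a"
    and \<sigma> :: "'a \<Rightarrow> 'a" +
  assumes not_abelian: "\<not> abelian"
    and hom_ideal_trivial: "hom_ideal I \<Longrightarrow> I = {0} \<or> I = UNIV"

locale strongly_simple_hom_lie_algebra = anticommutative_algebra scale br
  for scale :: "'f::field \<Rightarrow> 'a::ab_group_add \<Rightarrow> 'a" and br :: "'a \<Rightarrow> 'a \<Rightarrow> 'a" +
  assumes not_abelian: "\<not> abelian"
    and simple_if_twisting: "twisting_map \<sigma> \<Longrightarrow> simple_hom_lie_algebra scale br \<sigma>"

context anticommutative_algebra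
begin

definition multiplicative_simple_structure :: "('a \<Rightarrow> 'a) \<Rightarrow> bool" where
  "multiplicative_simple_structure \<sigma> \<longleftrightarrow> twisting_map \<sigma> \<and>
     (\<forall>x y. \<sigma> (br x y) = br (\<sigma> x) (\<sigma> y)) \<and> simple_hom_lie_algebra scale br \<sigma>"

end

text \<open>
  The two classes of algebras over \<open>'f\<close>, restricted to those with underlying additive group
  \<open>'a\<close>; an algebra is recorded as the pair of its scalar multiplication and its bracket, the
  twisting map not being part of the data.
\<close>

definition SS :: "(('f::field \<Rightarrow> 'a::ab_group_add \<Rightarrow> 'a) \<times> ('a \<Rightarrow> 'a \<Rightarrow> 'a)) set" where
  "SS = {(scale, br). strongly_simple_hom_lie_algebra scale br}"

definition MS :: "(('f::field \<Rightarrow> 'a::ab_group_add \<Rightarrow> 'a) \<times> ('a \<Rightarrow> 'a \<Rightarrow> 'a)) set" where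
  "MS = {(scale, br). anticommutative_algebra scale br \<and>
     (\<exists>\<sigma>. anticommutative_algebra.multiplicative_simple_structure scale br \<sigma>)}"

end

theory Submission
  imports Defs
begin

text \<open>
  The zero map is a multiplicative twisting map, so strong simplicity gives a multiplicative simple
  structure. Conversely, let \<open>\<sigma>\<close> be multiplicative with \<open>(A, \<sigma>)\<close> simple. Then \<open>[A, A]\<close> is a nonzero
  Hom-ideal, so \<open>A = [A, A]\<close>. For an ideal \<open>I\<close>, the Hom-Jacobi identity gives
  \<open>[\<sigma> I, [A, A]] \<subseteq> [[I, A], A]\<close>, hence \<open>\<sigma> [I, A] \<subseteq> [\<sigma> I, A] \<subseteq> [I, A]\<close>: the subspace \<open>[I, A]\<close> is a
  Hom-ideal. Either it is \<open>A\<close>, so \<open>I = A\<close>, or \<open>I\<close> is contained in the centre, which is itself a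
  proper Hom-ideal. Thus \<open>A\<close> is simple as an algebra, and every twisting map yields a simple
  Hom-Lie algebra.
\<close>

context anticommutative_algebra
begin

lemma module_hom_br_left: "module_hom scale scale (\<lambda>x. br x y)"
  using br_linear_left by (simp add: module_hom_iff_linear)

lemma module_hom_br_right: "module_hom scale scale (br x)"
  using br_linear_right by (simp add: module_hom_iff_linear)

lemmas br_zero_left = module_hom.zero[OF module_hom_br_left]
  and br_neg_left = module_hom.neg[OF module_hom_br_left]
  and br_add_left = module_hom.add[OF module_hom_br_left]
  and br_scale_left = module_hom.scale[OF module_hom_br_left]
  and br_add_right = module_hom.add[OF module_hom_br_right]

lemma br_swap: "br x y = - br y x"
  using br_self[of "x + y"] unfolding br_add_left br_add_right br_self[of x] br_self[of y]
  by (simp add: eq_neg_iff_add_eq_0 add.commute)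

lemma linear_image_span_subset:
  assumes f: "Vector_Spaces.linear scale scale f" and V: "subspace V" and S: "f ` S \<subseteq> V"
  shows "f ` span S \<subseteq> V"
proof -
  have "f ` span S = span (f ` S)"
    using f by (simp add: module_hom.span_image module_hom_iff_linear)
  then show ?thesis
    using span_minimal[OF S V] by simp
qed

lemma linear_zero_map: "Vector_Spaces.linear scale scale (\<lambda>_. 0)"
  by (simp add: module_hom_iff_linear[symmetric] module_hom_iff module_axioms)

lemma twisting_map_zero: "twisting_map (\<lambda>_. 0)"
  by (simp add: twisting_map_def linear_zero_map br_zero_left)

definition ideal :: "'a set \<Rightarrow> bool" where
  "ideal I \<longleftrightarrow> subspace I \<and> (\<forall>x\<in>I. \<forall>y. br x y \<in> I)"

text \<open>This is [I, A]; brackets alone need not be closed under addition. Perfectness of A reads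
  \<open>bracket_span UNIV = UNIV\<close>.\<close>

definition bracket_span :: "'a set \<Rightarrow> 'a set" where
  "bracket_span I = span {br x y |x y. x \<in> I}"

definition centre :: "'a set" where
  "centre = {x. \<forall>y. br x y = 0}"

lemma br_in_bracket_span: "x \<in> I \<Longrightarrow> br x y \<in> bracket_span I"
  unfolding bracket_span_def by (rule span_base) blast

lemma bracket_span_subset: "ideal I \<Longrightarrow> bracket_span I \<subseteq> I"
  unfolding bracket_span_def ideal_def by (rule span_minimal) auto

lemma ideal_bracket_span:
  assumes "ideal I"
  shows "ideal (bracket_span I)"
  using bracket_span_subset[OF assms] br_in_bracket_span
  by (auto simp: ideal_def bracket_span_def)

lemma ideal_UNIV: "ideal UNIV"
  by (simp add: ideal_def)

lemma ideal_centre: "ideal centre"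
  unfolding ideal_def centre_def
  by (auto intro!: subspaceI simp: br_zero_left br_add_left br_scale_left)

text \<open>Every Hom-ideal is an ideal, whatever the twisting map, so the condition on ideals need
  not mention \<open>\<sigma>\<close>.\<close>

lemma simple_hom_lie_algebraI:
  assumes "\<not> abelian" and "twisting_map \<sigma>" and "\<And>I. ideal I \<Longrightarrow> I = {0} \<or> I = UNIV"
  shows "simple_hom_lie_algebra scale br \<sigma>"
proof -
  interpret hom_lie_algebra scale br \<sigma>
    using assms(2) by unfold_locales
  show ?thesis
    using assms(1,3) by unfold_locales (auto simp: hom_ideal_def ideal_def)
qed

end

context hom_lie_algebra
begin

lemma linear_twist: "Vector_Spaces.linear scale scale \<sigma>"
  using twisting by (simp add: twisting_map_def)

text \<open>Solving for the term with \<open>\<sigma> x\<close> leaves, up to sign, only double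
  brackets that start from \<open>x\<close>.\<close>

lemma hom_jacobi: "br (\<sigma> x) (br y z) = br (br z x) (\<sigma> y) + br (br x y) (\<sigma> z)"
proof -
  have "br (\<sigma> x) (br y z) + br (\<sigma> y) (br z x) + br (\<sigma> z) (br x y) = 0"
    using twisting unfolding twisting_map_def by blast
  then have "br (\<sigma> x) (br y z) = - br (\<sigma> y) (br z x) - br (\<sigma> z) (br x y)"
    by (simp add: algebra_simps eq_neg_iff_add_eq_0)
  then show ?thesis
    using br_swap[of "br z x" "\<sigma> y"] br_swap[of "br x y" "\<sigma> z"] by simp
qed

text \<open>By \<open>hom_jacobi\<close>, \<open>br (\<sigma> x)\<close> sends every bracket into
  \<open>V\<close>, and brackets span A. Used with \<open>V\<close> zero for the centre and with
  \<open>V\<close> = [I, A] for an ideal.\<close>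

lemma br_twist_in_subspace:
  assumes perfect: "bracket_span UNIV = UNIV" and V: "subspace V"
    and in_V: "\<And>y z. br (br x y) z \<in> V"
  shows "br (\<sigma> x) a \<in> V"
proof -
  \<comment> \<open>The assumption covers only \<open>x\<close> as left factor; anticommutativity
    gives the other order.\<close>
  have "br (br z x) w \<in> V" for z w
    unfolding br_swap[of z x] br_neg_left using V in_V by (rule subspace_neg)
  then have "br (\<sigma> x) (br y z) \<in> V" for y z
    unfolding hom_jacobi[of x y z] using V in_V by (intro subspace_add)
  then have "br (\<sigma> x) ` bracket_span UNIV \<subseteq> V"
    unfolding bracket_span_def
    by (intro linear_image_span_subset br_linear_right V) auto
  then show ?thesis
    using perfect by auto
qed

lemma hom_ideal_centre:
  assumes "bracket_span UNIV = UNIV"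
  shows "hom_ideal centre"
proof -
  have "br (\<sigma> x) a = 0" if "x \<in> centre" for x a
  proof -
    have "br (br x y) z \<in> {0}" for y z
      using that ideal_centre unfolding ideal_def centre_def by auto
    then show ?thesis
      using br_twist_in_subspace[OF assms subspace_single_0] by blast
  qed
  then show ?thesis
    using ideal_centre by (auto simp: hom_ideal_def ideal_def centre_def)
qed

text \<open>By linearity of \<open>\<sigma>\<close>, invariance may be tested on the spanning
  brackets.\<close>

lemma hom_ideal_bracket_span:
  assumes "ideal I" and "\<And>x y. x \<in> I \<Longrightarrow> \<sigma> (br x y) \<in> bracket_span I"
  shows "hom_ideal (bracket_span I)"
proof -
  have "\<sigma> ` bracket_span I \<subseteq> bracket_span I"
    using linear_image_span_subset[OF linear_twist, of "bracket_span I" "{br x y |x y. x \<in> I}"] assms(2)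
    by (auto simp: bracket_span_def)
  then show ?thesis
    using ideal_bracket_span[OF assms(1)] by (simp add: hom_ideal_def ideal_def)
qed

end

context simple_hom_lie_algebra
begin

lemma ideal_trivial:
  assumes mult: "\<And>x y. \<sigma> (br x y) = br (\<sigma> x) (\<sigma> y)" and I: "ideal I"
  shows "I = {0} \<or> I = UNIV"
proof -
  \<comment> \<open>Perfectness is not yet available here; multiplicativity alone makes [A, A]
    invariant.\<close>
  have "hom_ideal (bracket_span UNIV)"
    using mult by (intro hom_ideal_bracket_span ideal_UNIV) (auto intro: br_in_bracket_span)
  moreover have "bracket_span UNIV \<noteq> {0}"
    using not_abelian br_in_bracket_span unfolding abelian_def by blast
  ultimately have perfect: "bracket_span UNIV = UNIV"
    using hom_ideal_trivial by blast
  have "centre \<noteq> UNIV"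
    using not_abelian unfolding abelian_def centre_def by blast
  then have centre: "centre = {0}"
    using hom_ideal_trivial hom_ideal_centre[OF perfect] by blast
  \<comment> \<open>After rewriting to [\<open>\<sigma> x\<close>, \<open>\<sigma> y\<close>], the
    second factor is treated as an arbitrary element of A.\<close>
  have "\<sigma> (br x y) \<in> bracket_span I" if "x \<in> I" for x y
    unfolding mult
  proof (rule br_twist_in_subspace[OF perfect])
    show "subspace (bracket_span I)"
      by (simp add: bracket_span_def)
    show "br (br x y) z \<in> bracket_span I" for y z
      using I that unfolding ideal_def by (intro br_in_bracket_span) blast
  qed
  then have "hom_ideal (bracket_span I)"
    using I by (intro hom_ideal_bracket_span)
  then consider "bracket_span I = {0}" | "bracket_span I = UNIV"
    using hom_ideal_trivial by blast
  then show ?thesis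
  proof cases
    case 1
    then have "I \<subseteq> centre"
      using br_in_bracket_span unfolding centre_def by blast
    then show ?thesis
      using centre I subspace_0 unfolding ideal_def by blast
  next
    case 2
    then show ?thesis
      using bracket_span_subset[OF I] by blast
  qed
qed

end

context anticommutative_algebra
begin

lemma strongly_simple_if_multiplicative_simple:
  assumes "multiplicative_simple_structure \<sigma>"
  shows "strongly_simple_hom_lie_algebra scale br"
proof -
  interpret simple_hom_lie_algebra scale br \<sigma>
    using assms by (simp add: multiplicative_simple_structure_def)
  \<comment> \<open>The given \<open>\<sigma>\<close> serves to show that ideals are trivial, a
    property of the bracket alone, which then applies to any \<open>\<tau>\<close>.\<close>
  have "simple_hom_lie_algebra scale br \<tau>" if "twisting_map \<tau>" for \<tau>
    using not_abelian that
  proof (rule simple_hom_lie_algebraI)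
    show "I = {0} \<or> I = UNIV" if "ideal I" for I
      using assms that by (intro ideal_trivial) (simp_all add: multiplicative_simple_structure_def)
  qed
  then show ?thesis
    using not_abelian by (intro strongly_simple_hom_lie_algebra.intro
        strongly_simple_hom_lie_algebra_axioms.intro anticommutative_algebra_axioms)
qed

end

lemma (in strongly_simple_hom_lie_algebra) multiplicative_simple_structure_zero:
  "multiplicative_simple_structure (\<lambda>_. 0)"
  using twisting_map_zero simple_if_twisting[OF twisting_map_zero]
  by (simp add: multiplicative_simple_structure_def br_self)

theorem theorem6p10:
  shows "(SS :: (('f::field \<Rightarrow> 'a::ab_group_add \<Rightarrow> 'a) \<times> ('a \<Rightarrow> 'a \<Rightarrow> 'a)) set) = MS"
proof -
  have "strongly_simple_hom_lie_algebra scale br \<longleftrightarrow> anticommutative_algebra scale br \<and>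
    (\<exists>\<sigma>. anticommutative_algebra.multiplicative_simple_structure scale br \<sigma>)"
    for scale :: "'f \<Rightarrow> 'a \<Rightarrow> 'a" and br
    using strongly_simple_hom_lie_algebra.multiplicative_simple_structure_zero[of scale br]
      strongly_simple_hom_lie_algebra.axioms(1)[of scale br]
      anticommutative_algebra.strongly_simple_if_multiplicative_simple[of scale br]
    by blast
  then show ?thesis
    by (simp add: SS_def MS_def)
qed

end
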